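(* Let $\Gamma$ be a distance-regular graph with diameter $D\ge 3$, fix a vertex $x$, and use the notation of the context. For subspaces $U\subseteq W$, write $U^\perp\cap W=\{w\in W:\langle w,u\rangle=0\ \forall u\in U\}$. Then: (1) $(M\cap M^* )^\perp\cap M$ has orthogonal basis $\{A_i\}_{i=1}^D$ and dimension $D$. (2) $(M\cap M^* )^\perp\cap M^*$ has orthogonal basis $\{A_i^*\}_{i=1}^D$ and dimension $D$. (3) $M^\perp\cap(M+M^* )$ has orthogonal basis $\{A_i^*\}_{i=1}^D$ and dimension $D$. (4) $(M^* )^\perp\cap(M+M^* )$ has orthogonal basis $\{A_i\}_{i=1}^D$ and dimension $D$. (5) $(M+M^* )^\perp\cap(MM^*\cap M^*M)$ has orthogonal basis $\{A_iA_j^*\mid 1\le i,j\le D,\ u_i(\theta_j)=\pm1\}$ and dimension $P$. (6) $(MM^*\cap M^*M)^\perp\cap MM^*$ has orthogonal basis $\{A_iA_j^*\mid 1\le i,j\le D,\ u_i(\theta_j)\ne\pm1\}$ and dimension $D^2-P$. (7) $(MM^*\cap M^*M)^\perp\cap M^*M$ has orthogonal basis $\{A_j^*A_i\mid 1\le i,j\le D,\ u_i(\theta_j)\ne\pm1\}$ and dimension $D^2-P$. (8) $(MM^* )^\perp\cap(MM^*+M^*M)$ has orthogonal basis $\{u_i(\theta_j)A_iA_j^*-A_j^*A_i\mid 1\le i,j\le D,\ u_i(\theta_j)\ne\pm1\}$ and dimension $D^2-P$. (9) $(M^*M)^\perp\cap(MM^*+M^*M)$ has orthogonal basis $\{A_iA_j^*-u_i(\theta_j)A_j^*A_i\mid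 1\le i,j\le D,\ u_i(\theta_j)\ne\pm1\}$ and dimension $D^2-P$.
   Context: Let $\Gamma=(X,\mathcal E)$ be a finite, undirected, connected graph without loops or multiple edges, with shortest-path distance $\partial$ and diameter $D\ge3$. $\Gamma$ is distance-regular: for all $0\le h,i,j\le D$ and $y,z\in X$ with $\partial(y,z)=h$, the number $p^h_{ij}=|\{w\in X:\partial(y,w)=i,\ \partial(z,w)=j\}|$ depends only on $h,i,j$. Write $k_i=p^0_{ii}$, $k=k_1$, $c_i=p^i_{1,i-1}$, $a_i=p^i_{1,i}$, $b_i=p^i_{1,i+1}$. Let $\mathrm{Mat}_X(\mathbb C)$ be the algebra of complex matrices indexed by $X$, with Hermitian inner product $\langle R,S\rangle=\mathrm{tr}(R^t\overline S)$. For $0\le i\le D$, $A_i$ is the $i$-th distance matrix ($(A_i)_{yz}=1$ if $\partial(y,z)=i$, else $0$); $A=A_1$, $A_0=I$. $M$ is the span of $A_0,\dots,A_D$. Let $E_0,\dots,E_D$ be the primitive idempotents of $M$ (a basis of $M$ with $E_0=|X|^{-1}J$, $\sum_iE_i=I$, $E_iE_j=\delta_{ij}E_i$, each $E_i$ real symmetric), $m_i=\mathrm{rank}(E_i)$, $\theta_i$ the eigenvalue of $A$ with $AE_i=\theta_iE_i$. Define $u_0,\dots,u_D\in\mathbb C[\lambda]$ by $u_0=1$, $u_1=\lambda/k$, $\lambda u_i=c_iu_{i-1}+a_iu_i+b_iu_{i+1}$ ($1\le i\le D-1$). Fix $x\in X$. $E_i^*$ is diagonal with $(y,y)$-entry $1$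 if $\partial(x,y)=i$, else $0$; $M^*$ is the span of $E_0^*,\dots,E_D^*$. $A_i^*$ is diagonal with $(A_i^* )_{yy}=|X|(E_i)_{xy}$; $A_0^*=I$. For subspaces $\mathcal R,\mathcal S$, $\mathcal R\mathcal S=\mathrm{Span}\{RS:R\in\mathcal R,S\in\mathcal S\}$. $P=|\{(i,j):1\le i,j\le D,\ u_i(\theta_j)=\pm1\}|$. *)

theory Defs
  imports "HOL-Analysis.Analysis" "HOL-Computational_Algebra.Polynomial"
begin

section \<open>Complex matrices indexed by a finite type\<close>

type_synonym 'x cmat = "complex ^ 'x ^ 'x"

definition cscale :: "complex \<Rightarrow> 'x::finite cmat \<Rightarrow> 'x cmat" (infixr "*\<^sub>C" 75) where
  "c *\<^sub>C R = map_matrix (\<lambda>z. c * z) R"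

text \<open>The library provides only real scalars for this type; the interpretation yields
  \<^emph>\<open>complex\<close> spans, independence and dimension, as \<open>cmat.span\<close>, \<open>cmat.independent\<close>, \<open>cmat.dim\<close>.\<close>

global_interpretation cmat: vector_space "cscale :: complex \<Rightarrow> 'x::finite cmat \<Rightarrow> 'x cmat"
  by unfold_locales (simp_all add: cscale_def vec_eq_iff algebra_simps)

definition herm :: "'x::finite cmat \<Rightarrow> 'x cmat \<Rightarrow> complex" where
  "herm R S = trace (transpose R ** map_matrix cnj S)"

definition orth_in :: "'x::finite cmat set \<Rightarrow> 'x cmat set \<Rightarrow> 'x cmat set" where
  "orth_in U W = {w \<in> W. \<forall>u\<in>U. herm w u = 0}"

definition basis_family :: "'i set \<Rightarrow> ('i \<Rightarrow> 'x::finite cmat) \<Rightarrow> 'x cmat set \<Rightarrow> bool" where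
  "basis_family I f W \<longleftrightarrow>
     inj_on f I \<and> cmat.independent (f ` I) \<and> cmat.span (f ` I) = W"

definition orthogonal_basis :: "'i set \<Rightarrow> ('i \<Rightarrow> 'x::finite cmat) \<Rightarrow> 'x cmat set \<Rightarrow> bool" where
  "orthogonal_basis I f W \<longleftrightarrow>
     basis_family I f W \<and> (\<forall>i\<in>I. \<forall>j\<in>I. i \<noteq> j \<longrightarrow> herm (f i) (f j) = 0)"

definition space_prod :: "'x::finite cmat set \<Rightarrow> 'x cmat set \<Rightarrow> 'x cmat set" (infixl "\<odot>" 75) where
  "U \<odot> V = cmat.span {R ** S | R S. R \<in> U \<and> S \<in> V}"


section \<open>Distance-regular graphs on a finite vertex type\<close>

definition connected_graph :: "('x::finite \<Rightarrow> 'x \<Rightarrow> bool) \<Rightarrow> bool" where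
  "connected_graph adj \<longleftrightarrow> symp adj \<and> irreflp adj \<and> (\<forall>y z. adj\<^sup>*\<^sup>* y z)"

definition gdist :: "('x::finite \<Rightarrow> 'x \<Rightarrow> bool) \<Rightarrow> 'x \<Rightarrow> 'x \<Rightarrow> nat" where
  "gdist adj y z = (LEAST n. (adj ^^ n) y z)"

definition diam :: "('x::finite \<Rightarrow> 'x \<Rightarrow> bool) \<Rightarrow> nat" where
  "diam adj = Max {gdist adj y z | y z. True}"

definition num_common :: "('x::finite \<Rightarrow> 'x \<Rightarrow> bool) \<Rightarrow> nat \<Rightarrow> nat \<Rightarrow> 'x \<Rightarrow> 'x \<Rightarrow> nat" where
  "num_common adj i j y z = card {w. gdist adj y w = i \<and> gdist adj z w = j}"

definition distance_regular :: "('x::finite \<Rightarrow> 'x \<Rightarrow> bool) \<Rightarrow> bool" where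
  "distance_regular adj \<longleftrightarrow> connected_graph adj \<and>
     (\<forall>h\<le>diam adj. \<forall>i\<le>diam adj. \<forall>j\<le>diam adj.
        \<exists>p. \<forall>y z. gdist adj y z = h \<longrightarrow> num_common adj i j y z = p)"

definition inum :: "('x::finite \<Rightarrow> 'x \<Rightarrow> bool) \<Rightarrow> nat \<Rightarrow> nat \<Rightarrow> nat \<Rightarrow> nat" where
  "inum adj h i j = (THE p. \<forall>y z. gdist adj y z = h \<longrightarrow> num_common adj i j y z = p)"

definition valency :: "('x::finite \<Rightarrow> 'x \<Rightarrow> bool) \<Rightarrow> nat" where
  "valency adj = inum adj 0 1 1"

definition c_num :: "('x::finite \<Rightarrow> 'x \<Rightarrow> bool) \<Rightarrow> nat \<Rightarrow> nat" where
  "c_num adj i = inum adj i 1 (i - 1)"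

definition a_num :: "('x::finite \<Rightarrow> 'x \<Rightarrow> bool) \<Rightarrow> nat \<Rightarrow> nat" where
  "a_num adj i = inum adj i 1 i"

definition b_num :: "('x::finite \<Rightarrow> 'x \<Rightarrow> bool) \<Rightarrow> nat \<Rightarrow> nat" where
  "b_num adj i = inum adj i 1 (i + 1)"

text \<open>The recurrence determines \<open>u 0, \<dots>, u D\<close> since \<open>b\<^sub>i \<noteq> 0\<close> for \<open>i < D\<close>;
  the values of \<open>u\<close> beyond \<open>D\<close> are left unconstrained.\<close>

definition u_polys :: "('x::finite \<Rightarrow> 'x \<Rightarrow> bool) \<Rightarrow> (nat \<Rightarrow> complex poly) \<Rightarrow> bool" where
  "u_polys adj u \<longleftrightarrow>
     u 0 = 1 \<and>
     u 1 = smult (1 / of_nat (valency adj)) [:0, 1:] \<and>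
     (\<forall>i. 1 \<le> i \<and> i < diam adj \<longrightarrow>
        [:0, 1:] * u i =
          smult (of_nat (c_num adj i)) (u (i - 1)) + smult (of_nat (a_num adj i)) (u i)
          + smult (of_nat (b_num adj i)) (u (i + 1)))"


section \<open>The Bose-Mesner algebra and its dual with respect to a vertex\<close>

definition dist_mat :: "('x::finite \<Rightarrow> 'x \<Rightarrow> bool) \<Rightarrow> nat \<Rightarrow> 'x cmat" where
  "dist_mat adj i = (\<chi> y z. if gdist adj y z = i then 1 else 0)"

definition bose_mesner :: "('x::finite \<Rightarrow> 'x \<Rightarrow> bool) \<Rightarrow> 'x cmat set" where
  "bose_mesner adj = cmat.span (dist_mat adj ` {0..diam adj})"

definition primitive_idempotents ::
    "('x::finite \<Rightarrow> 'x \<Rightarrow> bool) \<Rightarrow> (nat \<Rightarrow> 'x cmat) \<Rightarrow> bool" where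
  "primitive_idempotents adj E \<longleftrightarrow>
     basis_family {0..diam adj} E (bose_mesner adj) \<and>
     E 0 = (\<chi> y z. 1 / of_nat CARD('x)) \<and>
     (\<Sum>i = 0..diam adj. E i) = mat 1 \<and>
     (\<forall>i\<le>diam adj. \<forall>j\<le>diam adj. E i ** E j = (if i = j then E i else 0)) \<and>
     (\<forall>i\<le>diam adj. map_matrix cnj (E i) = E i \<and> transpose (E i) = E i)"

definition dual_idem :: "('x::finite \<Rightarrow> 'x \<Rightarrow> bool) \<Rightarrow> 'x \<Rightarrow> nat \<Rightarrow> 'x cmat" where
  "dual_idem adj x i = (\<chi> y z. if y = z \<and> gdist adj x y = i then 1 else 0)"

definition dual_bose_mesner :: "('x::finite \<Rightarrow> 'x \<Rightarrow> bool) \<Rightarrow> 'x \<Rightarrow> 'x cmat set" where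
  "dual_bose_mesner adj x = cmat.span (dual_idem adj x ` {0..diam adj})"

definition dual_dist_mat :: "(nat \<Rightarrow> 'x::finite cmat) \<Rightarrow> 'x \<Rightarrow> nat \<Rightarrow> 'x cmat" where
  "dual_dist_mat E x i = (\<chi> y z. if y = z then of_nat CARD('x) * E i $ x $ y else 0)"

end

theory Submission
  imports Defs
begin

text \<open>
  For \<open>0 \<le> i, j \<le> D\<close> put \<open>e\<^sub>i\<^sub>j = A\<^sub>i A\<^sub>j\<^sup>*\<close> and \<open>f\<^sub>i\<^sub>j = A\<^sub>j\<^sup>* A\<^sub>i\<close>. Each of the two families is
  orthogonal, both have the same norms, and \<open>\<langle>e\<^sub>i\<^sub>j, f\<^sub>r\<^sub>s\<rangle>\<close> vanishes unless \<open>(i, j) = (r, s)\<close>, when it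
  is \<open>u\<^sub>i(\<theta>\<^sub>j)\<close> times the common squared norm, because \<open>A\<^sub>i E\<^sub>j = k\<^sub>i u\<^sub>i(\<theta>\<^sub>j) E\<^sub>j\<close>. Hence \<open>M M\<^sup>* + M\<^sup>* M\<close>
  is an orthogonal sum of the spaces spanned by \<open>e\<^sub>i\<^sub>j\<close> and \<open>f\<^sub>i\<^sub>j\<close>; such a space is a line if
  \<open>u\<^sub>i(\<theta>\<^sub>j) = \<plusminus>1\<close> and a plane otherwise. Since \<open>A\<^sub>0 = A\<^sub>0\<^sup>* = I\<close>, the families \<open>e\<^sub>i\<^sub>0\<close> and \<open>e\<^sub>0\<^sub>j\<close> span
  \<open>M\<close> and \<open>M\<^sup>*\<close>, and every orthogonal complement can be computed one index \<open>(i, j)\<close> at a time.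
\<close>

section \<open>Hermitian geometry of complex matrices\<close>

lemma cscale_nth [simp]: "(c *\<^sub>C R) $ y $ z = c * R $ y $ z"
  by (simp add: cscale_def)

lemma herm_eq_sum: "herm R S = (\<Sum>z\<in>UNIV. \<Sum>y\<in>UNIV. R $ y $ z * cnj (S $ y $ z))"
  by (simp add: herm_def trace_def matrix_matrix_mult_def transpose_def)

lemma herm_0_left [simp]: "herm 0 S = 0"
  and herm_0_right [simp]: "herm R 0 = 0"
  by (simp_all add: herm_eq_sum)

lemma herm_add_left: "herm (R + R') S = herm R S + herm R' S"
  and herm_add_right: "herm R (S + S') = herm R S + herm R S'"
  by (simp_all add: herm_eq_sum algebra_simps sum.distrib)

lemma herm_diff_left: "herm (R - R') S = herm R S - herm R' S"
  and herm_diff_right: "herm R (S - S') = herm R S - herm R S'"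
  by (simp_all add: herm_eq_sum algebra_simps sum_subtractf)

lemma herm_scale_left: "herm (c *\<^sub>C R) S = c * herm R S"
  and herm_scale_right: "herm R (c *\<^sub>C S) = cnj c * herm R S"
  by (simp_all add: herm_eq_sum sum_distrib_left algebra_simps)

lemma herm_commute: "herm R S = cnj (herm S R)"
  by (simp add: herm_eq_sum mult.commute)

lemma herm_eq_0_commute: "herm R S = 0 \<longleftrightarrow> herm S R = 0"
  by (subst herm_commute) simp

text \<open>Positive definiteness: \<open>herm R R\<close> is the sum of the squared moduli of the
  entries, so it vanishes only if every entry does.\<close>

lemma herm_self_eq_0_iff [simp]: "herm R R = 0 \<longleftrightarrow> R = 0"
proof
  assume "herm R R = 0"
  moreover have "herm R R = of_real (\<Sum>z\<in>UNIV. \<Sum>y\<in>UNIV. (cmod (R $ y $ z))\<^sup>2)"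
    by (simp add: herm_eq_sum complex_norm_square del: of_real_power)
  ultimately have "(\<Sum>z\<in>UNIV. \<Sum>y\<in>UNIV. (cmod (R $ y $ z))\<^sup>2) = 0"
    by (simp only: of_real_eq_0_iff)
  then have "\<forall>z y. R $ y $ z = 0"
    by (simp add: sum_nonneg_eq_0_iff sum_nonneg)
  then show "R = 0"
    by (simp add: vec_eq_iff)
qed simp

lemma herm_span_right:
  assumes "S \<in> cmat.span U" and "\<And>u. u \<in> U \<Longrightarrow> herm R u = 0"
  shows "herm R S = 0"
  using assms(1)
  by (induction rule: cmat.span_induct_alt)
     (simp_all add: assms(2) herm_add_right herm_scale_right)

lemma herm_span_left:
  assumes "R \<in> cmat.span U" and "\<And>u. u \<in> U \<Longrightarrow> herm u S = 0"
  shows "herm R S = 0"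
  unfolding herm_eq_0_commute[of R S]
  using assms(1) by (rule herm_span_right) (simp add: assms(2) herm_eq_0_commute[of S])

lemma cmat_span_Un: "cmat.span (S \<union> T) = cmat.span S + cmat.span T"
  by (auto simp: cmat.span_Un set_plus_def)

section \<open>Orthogonal families and relative orthogonal complements\<close>

text \<open>The members are required to be nonzero so that orthogonality alone yields injectivity
  and linear independence.\<close>

definition orthogonal_family :: "'i set \<Rightarrow> ('i \<Rightarrow> 'x::finite cmat) \<Rightarrow> bool" where
  "orthogonal_family I g \<longleftrightarrow>
     (\<forall>i\<in>I. g i \<noteq> 0) \<and> (\<forall>i\<in>I. \<forall>j\<in>I. i \<noteq> j \<longrightarrow> herm (g i) (g j) = 0)"

lemma orthogonal_family_subset:
  "orthogonal_family I g \<Longrightarrow> J \<subseteq> I \<Longrightarrow> orthogonal_family J g"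
  by (simp add: orthogonal_family_def subset_iff)

lemma orthogonal_family_comp:
  assumes "orthogonal_family I g" "inj_on h J" "h ` J \<subseteq> I"
  shows "orthogonal_family J (\<lambda>i. g (h i))"
  using assms unfolding orthogonal_family_def inj_on_def image_subset_iff by metis

text \<open>A member lying in the span of the others, or equal to another one, would be orthogonal
  to itself and hence zero.\<close>

lemma orthogonal_basis_span:
  assumes "orthogonal_family I g"
  shows "orthogonal_basis I g (cmat.span (g ` I))" "cmat.dim (cmat.span (g ` I)) = card I"
proof -
  have inj: "inj_on g I"
    using assms unfolding orthogonal_family_def inj_on_def by (metis herm_self_eq_0_iff)
  have indep: "cmat.independent (g ` I)"
  proof
    assume "cmat.dependent (g ` I)"
    then obtain i where i: "i \<in> I" "g i \<in> cmat.span (g ` I - {g i})"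
      unfolding cmat.dependent_def by blast
    have "herm (g i) (g i) = 0"
      using i(2) by (rule herm_span_right) (use assms i(1) in \<open>auto simp: orthogonal_family_def\<close>)
    then show False
      using assms i(1) by (simp add: orthogonal_family_def)
  qed
  show "orthogonal_basis I g (cmat.span (g ` I))"
    using assms inj indep
    by (simp add: orthogonal_basis_def basis_family_def orthogonal_family_def)
  show "cmat.dim (cmat.span (g ` I)) = card I"
    using indep inj by (simp add: cmat.dim_span_eq_card_independent card_image del: cmat.dim_span)
qed

text \<open>Write \<open>w = p + q\<close> with \<open>p\<close> in \<open>U\<close>. As
  \<open>q\<close> is orthogonal to \<open>U\<close>, pairing \<open>w\<close> with \<open>p\<close>
  leaves \<open>herm p p\<close>, so \<open>p = 0\<close>.\<close>

lemma orth_in_sum_span: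
  assumes U: "cmat.subspace U"
    and perp: "\<And>i v. i \<in> I \<Longrightarrow> v \<in> U \<Longrightarrow> herm (g i) v = 0"
  shows "orth_in U (U + cmat.span (g ` I)) = cmat.span (g ` I)"
proof -
  have perp': "herm q v = 0" if "q \<in> cmat.span (g ` I)" "v \<in> U" for q v
    using that(1) by (rule herm_span_left) (use perp that(2) in auto)
  show ?thesis
  proof
    show "orth_in U (U + cmat.span (g ` I)) \<subseteq> cmat.span (g ` I)"
    proof
      fix w assume "w \<in> orth_in U (U + cmat.span (g ` I))"
      then obtain p q where w: "w = p + q" "p \<in> U" "q \<in> cmat.span (g ` I)"
        and "herm w p = 0"
        by (auto simp: orth_in_def set_plus_def)
      then have "herm p p = 0"
        using perp'[of q p] by (simp add: herm_add_left)
      then show "w \<in> cmat.span (g ` I)"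
        using w by simp
    qed
    show "cmat.span (g ` I) \<subseteq> orth_in U (U + cmat.span (g ` I))"
      using perp' cmat.subspace_0[OF U] by (force simp: orth_in_def set_plus_def)
  qed
qed

text \<open>The common pattern of all nine complements: it remains to decompose \<open>W\<close> and
  to check orthogonality of the generators to \<open>U\<close>.\<close>

lemma orthogonal_basis_orth_in:
  assumes "cmat.subspace U" "orthogonal_family I g" "W = U + cmat.span (g ` I)"
    and "\<And>i v. i \<in> I \<Longrightarrow> v \<in> U \<Longrightarrow> herm (g i) v = 0"
  shows "orthogonal_basis I g (orth_in U W) \<and> cmat.dim (orth_in U W) = card I"
  using orth_in_sum_span[of U I g] orthogonal_basis_span[of I g] assms by simp

text \<open>The component \<open>q\<close> of \<open>w\<close> in the span over \<open>J\<close> is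
  orthogonal to its own generators, hence to itself.\<close>

lemma span_image_orthogonal_part:
  assumes orth: "orthogonal_family K g" and "J \<subseteq> K"
    and w: "w \<in> cmat.span (g ` K)" "\<And>a. a \<in> J \<Longrightarrow> herm w (g a) = 0"
  shows "w \<in> cmat.span (g ` (K - J))"
proof -
  have "g ` K = g ` (K - J) \<union> g ` J"
    using \<open>J \<subseteq> K\<close> by blast
  then obtain p q where pq: "w = p + q" "p \<in> cmat.span (g ` (K - J))" "q \<in> cmat.span (g ` J)"
    using w(1) by (auto simp: cmat_span_Un set_plus_def)
  have "herm p (g a) = 0" if "a \<in> J" for a
    using pq(2) by (rule herm_span_left)
      (use orth that \<open>J \<subseteq> K\<close> in \<open>fastforce simp: orthogonal_family_def\<close>)
  then have "herm q (g a) = 0" if "a \<in> J" for a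
    using w(2)[OF that] that pq(1) by (simp add: herm_add_left)
  then have "herm q q = 0"
    using herm_span_right[OF pq(3)] by blast
  then show ?thesis
    using pq by simp
qed

section \<open>Products of spans\<close>

text \<open>Bilinearity of the matrix product, by one induction in each factor. It reduces products
  of algebras to products of their generators.\<close>

lemma space_prod_span:
  "cmat.span U \<odot> cmat.span V = cmat.span {R ** S | R S. R \<in> U \<and> S \<in> V}" (is "_ = cmat.span ?B")
proof -
  have lin: "(c *\<^sub>C R) ** S = c *\<^sub>C (R ** S)" "R ** (c *\<^sub>C S) = c *\<^sub>C (R ** S)"
    for c and R S :: "'a cmat"
    by (simp_all add: vec_eq_iff matrix_matrix_mult_def sum_distrib_left algebra_simps)
  have lin0: "0 ** S = 0" "R ** 0 = 0" for R S :: "'a cmat"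
    by (simp_all add: vec_eq_iff matrix_matrix_mult_def)
  have add: "(R + R') ** S = R ** S + R' ** S" for R R' S :: "'a cmat"
    by (simp add: vec_eq_iff matrix_matrix_mult_def algebra_simps sum.distrib)
  have "R ** S \<in> cmat.span ?B" if R: "R \<in> cmat.span U" and S: "S \<in> cmat.span V" for R S
    using R
  proof (induction rule: cmat.span_induct_alt)
    case base
    then show ?case by (simp add: lin0 cmat.span_zero)
  next
    case (step c R R')
    have "R ** S \<in> cmat.span ?B"
      using S
    proof (induction rule: cmat.span_induct_alt)
      case base
      then show ?case by (simp add: lin0 cmat.span_zero)
    next
      case (step d T T')
      then show ?case
        using \<open>R \<in> U\<close>
        unfolding matrix_add_ldistrib lin
        by (intro cmat.span_add cmat.span_scale) (auto intro: cmat.span_base)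
    qed
    then show ?case
      using step by (simp add: add lin cmat.span_add cmat.span_scale)
  qed
  then show ?thesis
    unfolding space_prod_def
    by (intro antisym cmat.span_minimal cmat.span_mono) (auto intro: cmat.span_base)
qed

section \<open>Two orthogonal families paired index by index\<close>

text \<open>Each index spans a subspace of dimension at most two, of which \<open>r a\<close> is the cosine
  of the angle between the two generators; different indices are orthogonal.\<close>

locale orthogonal_planes =
  fixes K :: "'i set" and e f :: "'i \<Rightarrow> 'x::finite cmat" and n r :: "'i \<Rightarrow> complex"
  assumes herm_ee: "a \<in> K \<Longrightarrow> b \<in> K \<Longrightarrow> herm (e a) (e b) = (if a = b then n a else 0)"
    and herm_ff: "a \<in> K \<Longrightarrow> b \<in> K \<Longrightarrow> herm (f a) (f b) = (if a = b then n a else 0)"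
    and herm_ef: "a \<in> K \<Longrightarrow> b \<in> K \<Longrightarrow> herm (e a) (f b) = (if a = b then n a * r a else 0)"
    and n_nonzero: "a \<in> K \<Longrightarrow> n a \<noteq> 0"
    and r_real: "a \<in> K \<Longrightarrow> cnj (r a) = r a"
begin

lemma n_real: "a \<in> K \<Longrightarrow> cnj (n a) = n a"
  using herm_commute[of "e a" "e a", symmetric] by (simp add: herm_ee)

lemma herm_fe: "a \<in> K \<Longrightarrow> b \<in> K \<Longrightarrow> herm (f a) (e b) = (if a = b then n a * r a else 0)"
  by (subst herm_commute) (simp add: herm_ef n_real r_real)

text \<open>Since \<open>n\<close> and \<open>r\<close> are real, \<open>e\<close> and
  \<open>f\<close> play symmetric roles, so each result about the span of \<open>e\<close> also
  serves the span of \<open>f\<close>.\<close>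

lemma swap: "orthogonal_planes K f e n r"
  by unfold_locales (simp_all add: herm_ee herm_ff herm_fe n_nonzero r_real)

lemma orthogonal_family_e: "orthogonal_family K e"
proof -
  have "e a \<noteq> 0" if "a \<in> K" for a
    using herm_ee[OF that that] n_nonzero[OF that] by auto
  then show ?thesis
    using herm_ee by (simp add: orthogonal_family_def)
qed

lemma r_square_eq_1_iff: "r a = 1 \<or> r a = -1 \<longleftrightarrow> r a * r a = 1"
  by (simp add: square_eq_1_iff)

text \<open>The equality case of Cauchy-Schwarz: the squared norm of the difference is
  \<open>n a * (1 - r a * r a)\<close>.\<close>

lemma f_eq_scale_e:
  assumes "a \<in> K" "r a = 1 \<or> r a = -1"
  shows "f a = r a *\<^sub>C e a"
proof -
  have "herm (f a - r a *\<^sub>C e a) (f a - r a *\<^sub>C e a) = n a * (1 - r a * r a)"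
    using assms(1)
    by (simp add: herm_diff_left herm_diff_right herm_scale_left herm_scale_right
          herm_ee herm_ff herm_ef herm_fe r_real algebra_simps)
  then have "herm (f a - r a *\<^sub>C e a) (f a - r a *\<^sub>C e a) = 0"
    using assms(2) by auto
  then show ?thesis
    by (simp only: herm_self_eq_0_iff) simp
qed

lemma span_Int:
  "cmat.span (e ` K) \<inter> cmat.span (f ` K) = cmat.span (e ` {a \<in> K. r a = 1 \<or> r a = -1})"
  (is "?L = cmat.span (e ` ?T)")
proof
  show "?L \<subseteq> cmat.span (e ` ?T)"
  proof
    fix w assume w: "w \<in> ?L"
    have "herm w (e a) = 0" if a: "a \<in> K - ?T" for a
    proof -
      \<comment> \<open>The vector \<open>f a - r a *\<^sub>C e a\<close> is orthogonal to every
        \<open>e b\<close>, and \<open>e a - r a *\<^sub>C f a\<close> to every \<open>f b\<close>;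
        \<open>w\<close> lies in both spans.\<close>
      have "herm w (f a - r a *\<^sub>C e a) = 0"
        by (rule herm_span_left[where U = "e ` K"])
          (use w a in \<open>auto simp: herm_diff_right herm_scale_right herm_ee herm_ef r_real\<close>)
      moreover have "herm w (e a - r a *\<^sub>C f a) = 0"
        by (rule herm_span_left[where U = "f ` K"])
          (use w a in \<open>auto simp: herm_diff_right herm_scale_right herm_ff herm_fe r_real\<close>)
      \<comment> \<open>The two equations form a homogeneous linear system in
        \<open>herm w (e a)\<close> and \<open>herm w (f a)\<close> with determinant
        \<open>1 - r a * r a\<close> up to sign.\<close>
      ultimately have "herm w (e a) * (1 - r a * r a) = 0"
        using a by (simp add: herm_diff_right herm_scale_right r_real algebra_simps)
      then show ?thesis
        using a r_square_eq_1_iff[of a] by auto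
    qed
    then have "w \<in> cmat.span (e ` (K - (K - ?T)))"
      using w by (intro span_image_orthogonal_part orthogonal_family_e) auto
    also have "K - (K - ?T) = ?T" by blast
    finally show "w \<in> cmat.span (e ` ?T)" .
  qed
  have "e a \<in> cmat.span (f ` K)" if "a \<in> ?T" for a
  proof -
    have "r a *\<^sub>C f a = (r a * r a) *\<^sub>C e a"
      using that f_eq_scale_e[of a] by simp
    then have "e a = r a *\<^sub>C f a"
      using that r_square_eq_1_iff[of a] by auto
    then show ?thesis
      using that by (metis (lifting) cmat.span_scale cmat.span_base imageI mem_Collect_eq)
  qed
  then show "cmat.span (e ` ?T) \<subseteq> ?L"
    by (intro cmat.span_minimal cmat.subspace_inter) (auto intro: cmat.span_base)
qed

text \<open>The intersection uses up exactly the \<open>e a\<close> with \<open>r a\<close> equal to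
  1 or -1; the remaining ones span the complement. Naming the intersection \<open>V\<close> lets the
  swapped version take its two factors in the other order.\<close>

lemma orthogonal_basis_Int_perp:
  assumes "N = {a \<in> K. \<not> (r a = 1 \<or> r a = -1)}"
    and "V = cmat.span (e ` K) \<inter> cmat.span (f ` K)"
  shows "orthogonal_basis N e (orth_in V (cmat.span (e ` K))) \<and>
    cmat.dim (orth_in V (cmat.span (e ` K))) = card N"
proof (rule orthogonal_basis_orth_in)
  let ?T = "{a \<in> K. r a = 1 \<or> r a = -1}"
  show "cmat.subspace V"
    by (simp add: assms(2) cmat.subspace_inter)
  show "orthogonal_family N e"
    using orthogonal_family_e assms(1) by (rule_tac orthogonal_family_subset) auto
  have "e ` K = e ` ?T \<union> e ` N"
    using assms(1) by blast
  then show "cmat.span (e ` K) = V + cmat.span (e ` N)"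
    unfolding assms(2) span_Int cmat_span_Un[symmetric] by (rule arg_cong)
  show "herm (e a) v = 0" if "a \<in> N" "v \<in> V" for a v
    using that(2) unfolding assms(2) span_Int
    by (rule herm_span_right) (use that(1) assms(1) in \<open>auto simp: herm_ee\<close>)
qed

lemma orthogonal_basis_sum_perp:
  assumes "N = {a \<in> K. \<not> (r a = 1 \<or> r a = -1)}"
    and "W = cmat.span (e ` K) + cmat.span (f ` K)"
    and g: "g = (\<lambda>a. r a *\<^sub>C e a - f a) \<or> g = (\<lambda>a. f a - r a *\<^sub>C e a)"
  shows "orthogonal_basis N g (orth_in (cmat.span (e ` K)) W) \<and>
    cmat.dim (orth_in (cmat.span (e ` K)) W) = card N"
proof (rule orthogonal_basis_orth_in)
  have NK: "N \<subseteq> K"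
    using assms(1) by blast
  have herm_g: "herm (g a) (g b) = (if a = b then n a * (1 - r a * r a) else 0)"
    if "a \<in> K" "b \<in> K" for a b
    using that g
    by (auto simp: herm_diff_left herm_diff_right herm_scale_left herm_scale_right
          herm_ee herm_ff herm_ef herm_fe r_real algebra_simps)
  show "orthogonal_family N g"
    unfolding orthogonal_family_def
  proof (intro conjI ballI impI)
    fix a assume a: "a \<in> N"
    then have "herm (g a) (g a) \<noteq> 0"
      using herm_g[of a a] n_nonzero[of a] r_square_eq_1_iff[of a] assms(1) by auto
    then show "g a \<noteq> 0" by auto
  qed (use herm_g NK in \<open>simp add: subset_iff\<close>)
  show "W = cmat.span (e ` K) + cmat.span (g ` N)"
    unfolding assms(2) cmat_span_Un[symmetric] cmat.span_eq
  proof (intro conjI subsetI)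
    fix w assume "w \<in> e ` K \<union> f ` K"
    \<comment> \<open>A generator \<open>f a\<close> is a multiple of \<open>e a\<close> when the
      plane degenerates to a line; otherwise it is recovered from \<open>e a\<close> and
      \<open>g a\<close>.\<close>
    then consider "w \<in> e ` K" | a where "a \<in> K" "w = f a" "a \<notin> N" | a where "a \<in> N" "w = f a"
      by blast
    then show "w \<in> cmat.span (e ` K \<union> g ` N)"
    proof cases
      case 1
      then show ?thesis by (simp add: cmat.span_base)
    next
      case (2 a)
      then have "w = r a *\<^sub>C e a"
        using assms(1) f_eq_scale_e by auto
      then show ?thesis
        using 2 by (auto intro!: cmat.span_scale intro: cmat.span_base)
    next
      case (3 a)
      have "w = r a *\<^sub>C e a - g a \<or> w = r a *\<^sub>C e a + g a"
        using g 3 by auto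
      moreover have "r a *\<^sub>C e a \<in> cmat.span (e ` K \<union> g ` N)" "g a \<in> cmat.span (e ` K \<union> g ` N)"
        using 3 NK by (auto intro!: cmat.span_scale intro: cmat.span_base)
      ultimately show ?thesis
        by (auto intro: cmat.span_add cmat.span_diff)
    qed
  next
    fix w assume "w \<in> e ` K \<union> g ` N"
    then show "w \<in> cmat.span (e ` K \<union> f ` K)"
      using g NK by (auto intro!: cmat.span_diff cmat.span_scale intro: cmat.span_base)
  qed
  show "herm (g a) v = 0" if "a \<in> N" "v \<in> cmat.span (e ` K)" for a v
    using that(2)
    by (rule herm_span_right)
       (use that(1) g NK in \<open>auto simp: herm_diff_left herm_scale_left herm_ee herm_fe\<close>)
qed (rule cmat.subspace_span)

end


section \<open>Distance-regular graphs\<close>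

lemma relpowp_sym:
  assumes "symp R" "(R ^^ n) y z"
  shows "(R ^^ n) z y"
  using assms(2)
proof (induction n arbitrary: z)
  case (Suc n)
  then obtain w where "(R ^^ n) y w" "R w z" by auto
  with Suc.IH assms(1) show ?case
    by (meson relpowp_Suc_I2 sympD)
qed auto

locale distance_regular_graph =
  fixes adj :: "'x::finite \<Rightarrow> 'x \<Rightarrow> bool"
  assumes distance_regular: "distance_regular adj"
begin

abbreviation d where "d \<equiv> gdist adj"
abbreviation D where "D \<equiv> diam adj"

lemma connected: "connected_graph adj"
  using distance_regular by (simp add: distance_regular_def)

lemma relpowp_gdist: "(adj ^^ d y z) y z"
proof -
  have "\<exists>n. (adj ^^ n) y z"
    using connected rtranclp_imp_relpowp unfolding connected_graph_def by metis
  then show ?thesis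
    unfolding gdist_def by (rule LeastI_ex)
qed

lemma gdist_le: "(adj ^^ n) y z \<Longrightarrow> d y z \<le> n"
  unfolding gdist_def by (rule Least_le)

lemma gdist_commute: "d y z = d z y"
proof -
  have "symp adj"
    using connected by (simp add: connected_graph_def)
  then have "d y z \<le> d z y" for y z
    using gdist_le[OF relpowp_sym[OF _ relpowp_gdist]] by blast
  from this[of y z] this[of z y] show ?thesis
    by simp
qed

lemma gdist_triangle: "d y z \<le> d y w + d w z"
  by (rule gdist_le) (rule relpowp_trans[OF relpowp_gdist relpowp_gdist])

lemma gdist_self [simp]: "d y y = 0"
  using gdist_le[of 0 y y] by simp

lemma gdist_eq_0_iff [simp]: "d y z = 0 \<longleftrightarrow> y = z"
  using relpowp_gdist[of y z] by auto

text \<open>Let \<open>w\<close> be the second vertex of a shortest walk from \<open>y\<close> to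
  \<open>z\<close>; the triangle inequality makes both upper bounds sharp.\<close>

lemma gdist_SucE:
  assumes "d y z = Suc n"
  obtains w where "d y w = 1" "d w z = n"
proof -
  obtain w where w: "adj y w" "(adj ^^ n) w z"
    using relpowp_gdist[of y z] assms by (metis relpowp_Suc_D2)
  have "d y w \<le> 1" "d w z \<le> n"
    using w by (simp_all only: gdist_le relpowp_1)
  moreover have "Suc n \<le> d y w + d w z"
    using gdist_triangle[of y z w] assms by simp
  ultimately have "d y w = 1" "d w z = n"
    by simp_all
  then show thesis
    by (rule that)
qed

lemma finite_gdists: "finite {d y z | y z. True}"
proof -
  have "{d y z | y z. True} = (\<lambda>(y, z). d y z) ` UNIV" by auto
  then show ?thesis by simp
qed

lemma gdist_le_diam: "d y z \<le> D"
  unfolding diam_def by (rule Max_ge[OF finite_gdists]) blast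

text \<open>Downward induction: the diameter is attained, and one step along a shortest walk lowers
  the distance by one.\<close>

lemma ex_gdist: "i \<le> D \<Longrightarrow> \<exists>y z. d y z = i"
proof (induction i rule: inc_induct)
  case base
  have "D \<in> {d y z | y z. True}"
    unfolding diam_def by (rule Max_in[OF finite_gdists]) blast
  then show ?case by (simp add: eq_commute)
next
  case (step i)
  then show ?case by (metis gdist_SucE)
qed

section \<open>Intersection numbers\<close>

text \<open>The pair \<open>y\<close>, \<open>z\<close> at distance \<open>h\<close> makes the
  constant in the definite description unique.\<close>

lemma num_common_eq_inum:
  assumes "d y z = h" "i \<le> D" "j \<le> D"
  shows "num_common adj i j y z = inum adj h i j"
proof -
  have "h \<le> D"
    using assms(1) gdist_le_diam by blast
  then obtain p where p: "\<forall>y z. d y z = h \<longrightarrow> num_common adj i j y z = p"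
    using distance_regular assms unfolding distance_regular_def by meson
  then have "inum adj h i j = p"
    unfolding inum_def using assms(1) by (intro the_equality) auto
  then show ?thesis
    using p assms(1) by simp
qed

lemma card_sphere: "i \<le> D \<Longrightarrow> card {w. d y w = i} = inum adj 0 i i"
  using num_common_eq_inum[of y y 0 i i] by (simp add: num_common_def)

lemma sphere_size_pos: "i \<le> D \<Longrightarrow> inum adj 0 i i \<noteq> 0"
  using ex_gdist[of i] card_sphere[of i] by (metis (mono_tags) card_eq_0_iff empty_Collect_eq finite)

text \<open>If \<open>y\<close> follows \<open>w\<close> on a shortest walk of length
  \<open>i + 1\<close> to \<open>z\<close>, then \<open>w\<close> is among the vertices counted.
  This permits dividing by \<open>b_num adj i\<close> in the recurrence for
  \<open>u\<close>.\<close>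

lemma b_num_pos:
  assumes "i < D"
  shows "b_num adj i \<noteq> 0"
proof -
  obtain w z where "d w z = Suc i"
    using ex_gdist[of "Suc i"] assms by auto
  moreover from this obtain y where y: "d w y = 1" "d y z = i"
    by (rule gdist_SucE)
  ultimately have "w \<in> {w. d y w = 1 \<and> d z w = i + 1}"
    by (simp add: gdist_commute)
  then have "num_common adj 1 (i + 1) y z \<noteq> 0"
    unfolding num_common_def by (metis card_eq_0_iff empty_iff finite)
  then show ?thesis
    using num_common_eq_inum[OF y(2), of 1 "i + 1"] assms by (simp add: b_num_def)
qed

text \<open>Group the neighbours \<open>w\<close> of \<open>y\<close> by their distance to
  \<open>z\<close>, which differs from \<open>i\<close> by at most one.\<close>

lemma sum_neighbours:
  fixes q :: "nat \<Rightarrow> complex"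
  assumes "d y z = i" "1 \<le> i" "i < D"
  shows "(\<Sum>w | d y w = 1. q (d w z)) =
    of_nat (c_num adj i) * q (i - 1) + of_nat (a_num adj i) * q i + of_nat (b_num adj i) * q (i + 1)"
proof -
  have "(\<Sum>w | d y w = 1. q (d w z)) = (\<Sum>w | d y w = 1. q (d z w))"
    by (simp add: gdist_commute)
  also have "\<dots> = (\<Sum>j\<in>{i - 1, i, i + 1}. \<Sum>w | w \<in> {w. d y w = 1} \<and> d z w = j. q (d z w))"
  proof (rule sum.group[symmetric])
    show "d z ` {w. d y w = 1} \<subseteq> {i - 1, i, i + 1}"
    proof
      fix j assume "j \<in> d z ` {w. d y w = 1}"
      then obtain w where w: "d y w = 1" "j = d z w" by auto
      then have "j \<le> i + 1" "i \<le> j + 1"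
        using gdist_triangle[of z w y] gdist_triangle[of z y w] assms(1) gdist_commute[of y z]
          gdist_commute[of y w] by simp_all
      then show "j \<in> {i - 1, i, i + 1}" by auto
    qed
  qed simp_all
  also have "\<dots> = (\<Sum>j\<in>{i - 1, i, i + 1}. of_nat (inum adj i 1 j) * q j)"
  proof (rule sum.cong)
    fix j assume "j \<in> {i - 1, i, i + 1}"
    then have "card {w. d y w = 1 \<and> d z w = j} = inum adj i 1 j"
      using num_common_eq_inum[OF assms(1), of 1 j] assms by (auto simp: num_common_def)
    then show "(\<Sum>w | w \<in> {w. d y w = 1} \<and> d z w = j. q (d z w)) = of_nat (inum adj i 1 j) * q j"
      by simp
  qed simp
  also have "\<dots> = of_nat (inum adj i 1 (i - 1)) * q (i - 1) + of_nat (inum adj i 1 i) * q i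
      + of_nat (inum adj i 1 (i + 1)) * q (i + 1)"
  proof -
    \<comment> \<open>For \<open>i = 0\<close> truncated subtraction would identify the first two
      indices.\<close>
    have "i - 1 \<noteq> i" "i - 1 \<noteq> i + 1" "i \<noteq> i + 1"
      using assms(2) by auto
    then show ?thesis
      by (simp only: sum.insert sum.empty finite.intros insert_iff empty_iff simp_thms
            add_0_right add.assoc not_False_eq_True)
  qed
  finally show ?thesis
    by (simp only: c_num_def a_num_def b_num_def)
qed

lemma bose_mesner_entries:
  assumes "R \<in> bose_mesner adj"
  obtains q where "\<And>y z. R $ y $ z = q (d y z)"
proof -
  from assms have "\<exists>q. \<forall>y z. R $ y $ z = q (d y z)"
    unfolding bose_mesner_def
  proof (induction rule: cmat.span_induct_alt)
    case base
    show ?case by (rule exI[of _ "\<lambda>_. 0"]) simp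
  next
    case (step c R R')
    then obtain i q where "R = dist_mat adj i" "\<forall>y z. R' $ y $ z = q (d y z)" by auto
    then show ?case
      by (intro exI[of _ "\<lambda>h. c * (if h = i then 1 else 0) + q h"]) (simp add: dist_mat_def)
  qed
  then show thesis using that by blast
qed

end

section \<open>Primitive idempotents and the polynomials u\<close>

locale distance_regular_idempotents = distance_regular_graph adj
  for adj :: "'x::finite \<Rightarrow> 'x \<Rightarrow> bool" +
  fixes E :: "nat \<Rightarrow> 'x cmat" and \<theta> :: "nat \<Rightarrow> complex" and u :: "nat \<Rightarrow> complex poly"
    and x :: 'x
  assumes idempotents: "primitive_idempotents adj E"
    and eigenvalue: "j \<le> D \<Longrightarrow> dist_mat adj 1 ** E j = \<theta> j *\<^sub>C E j"
    and u_polys: "u_polys adj u"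
begin

abbreviation A where "A \<equiv> dist_mat adj"
abbreviation A' where "A' \<equiv> dual_dist_mat E x"
abbreviation M where "M \<equiv> bose_mesner adj"
abbreviation M' where "M' \<equiv> dual_bose_mesner adj x"
abbreviation K where "K \<equiv> {0..D} \<times> {0..D}"
abbreviation e where "e \<equiv> \<lambda>(i, j). A i ** A' j"
abbreviation f where "f \<equiv> \<lambda>(i, j). A' j ** A i"
abbreviation r where "r \<equiv> \<lambda>(i, j). poly (u i) (\<theta> j)"

lemma span_E: "cmat.span (E ` {0..D}) = M"
  using idempotents by (simp add: primitive_idempotents_def basis_family_def)

lemma E_in_bose_mesner: "j \<le> D \<Longrightarrow> E j \<in> M"
  unfolding span_E[symmetric] by (rule cmat.span_base) simp

lemma E_mult: "i \<le> D \<Longrightarrow> j \<le> D \<Longrightarrow> E i ** E j = (if i = j then E i else 0)"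
  using idempotents by (simp add: primitive_idempotents_def)

lemma E_nonzero: "j \<le> D \<Longrightarrow> E j \<noteq> 0"
  using idempotents cmat.dependent_zero[of "E ` {0..D}"]
  unfolding primitive_idempotents_def basis_family_def
  by (metis atLeastAtMost_iff imageI le0)

lemma cnj_E: "j \<le> D \<Longrightarrow> cnj (E j $ y $ z) = E j $ y $ z"
  using idempotents nth_map_matrix[of cnj "E j" y z] by (simp add: primitive_idempotents_def)

lemma E_commute: "j \<le> D \<Longrightarrow> E j $ y $ z = E j $ z $ y"
  using idempotents unfolding primitive_idempotents_def transpose_def
  by (metis (lifting) vec_lambda_beta)

lemma E_0: "E 0 $ y $ z = 1 / of_nat CARD('x)"
  using idempotents by (simp add: primitive_idempotents_def)

text \<open>The entries of \<open>E j\<close> depend only on the distance, and reading \<open>A E\<^sub>j = \<theta>\<^sub>j E\<^sub>j\<close> entrywise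
  gives the recurrence that defines \<open>u\<close>.\<close>

lemma E_entry:
  assumes j: "j \<le> D"
  shows "E j $ y $ z = poly (u (d y z)) (\<theta> j) * E j $ v $ v"
proof -
  obtain q where q: "\<And>y z. E j $ y $ z = q (d y z)"
    using bose_mesner_entries[OF E_in_bose_mesner[OF j]] by blast
  have sum_q: "(\<Sum>w | d y w = 1. q (d w z)) = \<theta> j * q (d y z)" for y z
  proof -
    have "(\<Sum>w | d y w = 1. q (d w z)) = (A 1 ** E j) $ y $ z"
      by (simp add: matrix_matrix_mult_def dist_mat_def q if_distrib[of "\<lambda>c. c * _"]
            sum.If_cases cong: if_cong)
    then show ?thesis
      by (simp only: eigenvalue[OF j] cscale_nth q)
  qed
  have "i \<le> D \<Longrightarrow> q i = poly (u i) (\<theta> j) * q 0" for i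
  \<comment> \<open>The recurrence reaches back two places, hence strong induction.\<close>
  proof (induction i rule: less_induct)
    case (less i)
    consider "i = 0" | "i = 1" | m where "i = m + 1" "1 \<le> m" "m < D"
      using less.prems by (cases i) force+
    then show ?case
    proof cases
      case 1
      then show ?thesis
        using u_polys by (simp add: u_polys_def)
    next
      case 2
      \<comment> \<open>On the diagonal all neighbours contribute the same value \<open>q 1\<close>,
        so the eigenvalue equation gives valency times \<open>q 1\<close>.\<close>
      have "of_nat (card {w. d v w = 1}) * q 1 = (\<Sum>w | d v w = 1. q (d w v))"
        by (simp add: gdist_commute)
      then have "of_nat (valency adj) * q 1 = \<theta> j * q 0"
        using sum_q[of v v] card_sphere[of 1 v] less.prems 2 by (simp add: valency_def)
      moreover have "valency adj \<noteq> 0"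
        using sphere_size_pos[of 1] less.prems 2 by (simp add: valency_def)
      ultimately show ?thesis
        using u_polys 2 by (simp add: u_polys_def field_simps)
    next
      case (3 m)
      obtain y z where yz: "d y z = m"
        using ex_gdist[of m] 3 by auto
      have "\<theta> j * q m = of_nat (c_num adj m) * q (m - 1) + of_nat (a_num adj m) * q m
          + of_nat (b_num adj m) * q (m + 1)"
        using sum_neighbours[OF yz, of q] sum_q[where y = y and z = z] yz 3 by simp
      then have *: "of_nat (b_num adj m) * q (m + 1) =
          (\<theta> j * poly (u m) (\<theta> j) - of_nat (c_num adj m) * poly (u (m - 1)) (\<theta> j)
            - of_nat (a_num adj m) * poly (u m) (\<theta> j)) * q 0"
        using less.IH[of m] less.IH[of "m - 1"] 3 by (simp add: algebra_simps)
      have "[:0, 1:] * u m = smult (of_nat (c_num adj m)) (u (m - 1))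
          + smult (of_nat (a_num adj m)) (u m) + smult (of_nat (b_num adj m)) (u (m + 1))"
        using u_polys 3 by (simp add: u_polys_def)
      from arg_cong[OF this, of "\<lambda>p. poly p (\<theta> j)"]
      have "\<theta> j * poly (u m) (\<theta> j) = of_nat (c_num adj m) * poly (u (m - 1)) (\<theta> j)
          + of_nat (a_num adj m) * poly (u m) (\<theta> j)
          + of_nat (b_num adj m) * poly (u (m + 1)) (\<theta> j)"
        by simp
      \<comment> \<open>The values \<open>q i\<close> obey the recurrence of \<open>u\<close>
        evaluated at \<open>\<theta> j\<close>; the nonzero coefficient \<open>b_num adj m\<close>
        is then cancelled.\<close>
      with * have "of_nat (b_num adj m) * q (m + 1)
          = of_nat (b_num adj m) * (poly (u (m + 1)) (\<theta> j) * q 0)"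
        by simp
      then show ?thesis
        using b_num_pos[of m] 3 by simp
    qed
  qed
  from this[OF gdist_le_diam[of y z]] show ?thesis
    by (simp add: q)
qed

text \<open>Every entry of \<open>E j\<close> is a multiple of any given diagonal entry, so a zero
  on the diagonal would force \<open>E j = 0\<close>.\<close>

lemma E_diag_nonzero:
  assumes "j \<le> D"
  shows "E j $ v $ v \<noteq> 0"
proof
  assume "E j $ v $ v = 0"
  then have "E j $ y $ z = 0" for y z
    by (subst E_entry[OF assms, of y z v]) simp
  then have "E j = 0"
    by (simp add: vec_eq_iff)
  then show False
    using E_nonzero[OF assms] by contradiction
qed

text \<open>The value is a quotient of two entries of the real matrix \<open>E j\<close>.\<close>

lemma r_real:
  assumes "i \<le> D" "j \<le> D"
  shows "cnj (poly (u i) (\<theta> j)) = poly (u i) (\<theta> j)"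
proof -
  obtain y z where "d y z = i"
    using ex_gdist assms(1) by blast
  then have "poly (u i) (\<theta> j) = E j $ y $ z / E j $ y $ y"
    using E_entry[OF assms(2), of y z y] E_diag_nonzero[OF assms(2), of y] by simp
  then show ?thesis
    by (simp add: cnj_E[OF assms(2)])
qed

text \<open>Expanding in the idempotents shows that \<open>R ** E j\<close> is a multiple of
  \<open>E j\<close> for every \<open>R\<close> in \<open>M\<close>; the factor for
  \<open>A i\<close> is then found from one diagonal entry.\<close>

lemma dist_mat_mult_E:
  assumes "i \<le> D" "j \<le> D"
  shows "A i ** E j = (of_nat (inum adj 0 i i) * poly (u i) (\<theta> j)) *\<^sub>C E j"
proof -
  have "\<exists>c. R ** E j = c *\<^sub>C E j" if "R \<in> M" for R
    using that unfolding span_E[symmetric]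
  proof (induction rule: cmat.span_induct_alt)
    case base
    show ?case
      by (rule exI[of _ 0]) (simp add: vec_eq_iff matrix_matrix_mult_def)
  next
    case (step c R R')
    then obtain l c' where l: "R = E l" "l \<le> D" "R' ** E j = c' *\<^sub>C E j" by fastforce
    have "(c *\<^sub>C R + R') ** E j = c *\<^sub>C (R ** E j) + R' ** E j"
      by (simp add: vec_eq_iff matrix_matrix_mult_def sum_distrib_left algebra_simps sum.distrib)
    also have "\<dots> = ((if l = j then c else 0) + c') *\<^sub>C E j"
      using l E_mult[of l j] assms(2) by (simp add: cmat.scale_left_distrib)
    finally show ?case by blast
  qed
  moreover have "A i \<in> M"
    unfolding bose_mesner_def using assms(1) by (intro cmat.span_base) simp
  ultimately obtain c where c: "A i ** E j = c *\<^sub>C E j" by blast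
  \<comment> \<open>The sphere of radius \<open>i\<close> about \<open>x\<close> contributes equal
    terms, by \<open>E_entry\<close>.\<close>
  have "c * E j $ x $ x = (A i ** E j) $ x $ x"
    by (simp add: c)
  also have "\<dots> = (\<Sum>w | d x w = i. E j $ w $ x)"
    by (simp add: matrix_matrix_mult_def dist_mat_def if_distrib[of "\<lambda>c. c * _"]
          sum.If_cases cong: if_cong)
  also have "\<dots> = (\<Sum>w | d x w = i. poly (u i) (\<theta> j) * E j $ x $ x)"
  proof (rule sum.cong)
    fix w assume "w \<in> {w. d x w = i}"
    then show "E j $ w $ x = poly (u i) (\<theta> j) * E j $ x $ x"
      by (subst E_entry[OF assms(2), of w x x]) (simp add: gdist_commute[of w x])
  qed simp
  also have "\<dots> = of_nat (inum adj 0 i i) * poly (u i) (\<theta> j) * E j $ x $ x"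
    using card_sphere[OF assms(1), of x] by simp
  finally show ?thesis
    using c E_diag_nonzero[OF assms(2), of x] by simp
qed

section \<open>Inner products of the matrix products\<close>

text \<open>Right multiplication by a diagonal matrix scales columns, so \<open>E j\<close> is read
  at \<open>z\<close>; left multiplication in \<open>f_nth\<close> scales rows, so it is read at
  \<open>y\<close>.\<close>

lemma e_nth: "(A i ** A' j) $ y $ z = (if d y z = i then of_nat CARD('x) * E j $ x $ z else 0)"
proof -
  have "(A i ** A' j) $ y $ z =
      (\<Sum>w\<in>UNIV. if w = z then (if d y z = i then of_nat CARD('x) * E j $ x $ z else 0) else 0)"
    by (simp only: matrix_matrix_mult_def vec_lambda_beta, rule sum.cong) (auto simp: dist_mat_def dual_dist_mat_def)
  then show ?thesis by simp
qed

lemma f_nth: "(A' j ** A i) $ y $ z = (if d y z = i then of_nat CARD('x) * E j $ x $ y else 0)"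
proof -
  have "(A' j ** A i) $ y $ z =
      (\<Sum>w\<in>UNIV. if w = y then (if d y z = i then of_nat CARD('x) * E j $ x $ y else 0) else 0)"
    by (simp only: matrix_matrix_mult_def vec_lambda_beta, rule sum.cong) (auto simp: dist_mat_def dual_dist_mat_def)
  then show ?thesis by simp
qed

lemma A_0: "A 0 = mat 1"
  by (simp add: vec_eq_iff dist_mat_def mat_def)

lemma A'_0: "A' 0 = mat 1"
  by (simp add: vec_eq_iff dual_dist_mat_def mat_def E_0)

lemma sum_sphere:
  assumes "i \<le> D"
  shows "(\<Sum>y\<in>UNIV. if d y z = i then c else 0) = of_nat (inum adj 0 i i) * (c::complex)"
    and "(\<Sum>y\<in>UNIV. if d z y = i then c else 0) = of_nat (inum adj 0 i i) * c"
  using card_sphere[OF assms, of z] gdist_commute[of _ z] by (simp_all add: sum.If_cases)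

text \<open>By symmetry of the idempotents the sum is the \<open>(x, x)\<close> entry of
  \<open>E j ** E j'\<close>.\<close>

lemma sum_E_E:
  assumes "j \<le> D" "j' \<le> D"
  shows "(\<Sum>z\<in>UNIV. E j $ x $ z * E j' $ x $ z) = (if j = j' then E j $ x $ x else 0)"
proof -
  have "(\<Sum>z\<in>UNIV. E j $ x $ z * E j' $ x $ z) = (E j ** E j') $ x $ x"
    by (simp add: matrix_matrix_mult_def E_commute[OF assms(2), of x])
  then show ?thesis
    by (simp add: E_mult assms)
qed

text \<open>The double sum is the \<open>(x, x)\<close> entry of
  \<open>E j ** A i ** E j'\<close>.\<close>

lemma sum_E_A_E:
  assumes "i \<le> D" "j \<le> D" "j' \<le> D"
  shows "(\<Sum>z\<in>UNIV. \<Sum>y\<in>UNIV. if d y z = i then E j $ x $ z * E j' $ x $ y else 0) =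
    (if j = j' then of_nat (inum adj 0 i i) * poly (u i) (\<theta> j) * E j $ x $ x else 0)"
proof -
  have "(A i ** E j') $ z $ x = (\<Sum>y\<in>UNIV. if d y z = i then E j' $ x $ y else 0)" for z
    by (simp only: matrix_matrix_mult_def vec_lambda_beta, rule sum.cong) (auto simp: dist_mat_def gdist_commute E_commute[OF assms(3)])
  then have "(\<Sum>z\<in>UNIV. \<Sum>y\<in>UNIV. if d y z = i then E j $ x $ z * E j' $ x $ y else 0) =
      (E j ** (A i ** E j')) $ x $ x"
    by (simp add: matrix_matrix_mult_def[of "E j"] sum_distrib_left if_distrib cong: if_cong)
  also have "\<dots> = of_nat (inum adj 0 i i) * poly (u i) (\<theta> j') * (E j ** E j') $ x $ x"
    unfolding dist_mat_mult_E[OF assms(1,3)]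
    by (simp add: matrix_matrix_mult_def sum_distrib_left algebra_simps)
  finally show ?thesis
    by (simp add: E_mult assms)
qed

text \<open>The common squared norm of \<open>e (i, j)\<close> and \<open>f (i, j)\<close>. As the
  diagonal of \<open>E j\<close> is constant and its trace is its rank, this equals |X| times the
  i-th sphere size times the rank of \<open>E j\<close>.\<close>

abbreviation n where
  "n \<equiv> \<lambda>(i, j). of_nat (inum adj 0 i i) * of_nat CARD('x) ^ 2 * E j $ x $ x"

sublocale orthogonal_planes K e f n r
proof
  fix a b assume "a \<in> K" "b \<in> K"
  then obtain i j i' j' where ab: "a = (i, j)" "b = (i', j')"
    and le: "i \<le> D" "j \<le> D" "i' \<le> D" "j' \<le> D" by auto
  let ?X = "of_nat CARD('x) :: complex"
  show "herm (e a) (e b) = (if a = b then n a else 0)"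
  \<comment> \<open>For distinct \<open>i\<close> and \<open>i'\<close> the matrices have disjoint
    supports. Otherwise each column \<open>z\<close> contributes one sphere of equal terms, which
    leaves \<open>sum_E_E\<close>.\<close>
  proof (cases "i = i'")
    case True
    have "herm (e a) (e b) = (\<Sum>z\<in>UNIV. \<Sum>y\<in>UNIV.
        if d y z = i then ?X ^ 2 * (E j $ x $ z * E j' $ x $ z) else 0)"
      unfolding herm_eq_sum ab
      by (intro sum.cong) (auto simp: e_nth True cnj_E le power2_eq_square)
    also have "\<dots> = of_nat (inum adj 0 i i) * ?X ^ 2 * (\<Sum>z\<in>UNIV. E j $ x $ z * E j' $ x $ z)"
      by (simp add: sum_sphere le sum_distrib_left mult.assoc)
    finally show ?thesis
      using True by (auto simp: sum_E_E le ab)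
  qed (auto simp: herm_eq_sum e_nth ab intro!: sum.neutral)
  show "herm (f a) (f b) = (if a = b then n a else 0)"
  proof (cases "i = i'")
    case True
    have "herm (f a) (f b) = (\<Sum>z\<in>UNIV. \<Sum>y\<in>UNIV.
        if d y z = i then ?X ^ 2 * (E j $ x $ y * E j' $ x $ y) else 0)"
      unfolding herm_eq_sum ab
      by (intro sum.cong) (auto simp: f_nth True cnj_E le power2_eq_square)
    \<comment> \<open>The summand now depends on the row \<open>y\<close>, so the order of summation
      is exchanged first.\<close>
    also have "\<dots> = of_nat (inum adj 0 i i) * ?X ^ 2 * (\<Sum>y\<in>UNIV. E j $ x $ y * E j' $ x $ y)"
      by (subst sum.swap) (simp add: sum_sphere le sum_distrib_left mult.assoc)
    finally show ?thesis
      using True by (auto simp: sum_E_E le ab)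
  qed (auto simp: herm_eq_sum f_nth ab intro!: sum.neutral)
  show "herm (e a) (f b) = (if a = b then n a * r a else 0)"
  proof (cases "i = i'")
    case True
    have "herm (e a) (f b) = ?X ^ 2 * (\<Sum>z\<in>UNIV. \<Sum>y\<in>UNIV.
        if d y z = i then E j $ x $ z * E j' $ x $ y else 0)"
      unfolding herm_eq_sum ab sum_distrib_left
      by (intro sum.cong) (auto simp: e_nth f_nth True cnj_E le power2_eq_square)
    then show ?thesis
      using True by (auto simp: sum_E_A_E le ab)
  qed (auto simp: herm_eq_sum e_nth f_nth ab intro!: sum.neutral)
  show "n a \<noteq> 0" "cnj (r a) = r a"
    using sphere_size_pos[of i] E_diag_nonzero[of j x] r_real[of i j] le by (simp_all add: ab)
qed

section \<open>Index zero and the spans of the algebras\<close>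

lemma r_0_left: "r (0, j) = 1"
  using u_polys by (simp add: u_polys_def)

text \<open>All entries of \<open>E 0\<close> are equal, so their quotient is 1.\<close>

lemma r_0_right:
  assumes "i \<le> D"
  shows "r (i, 0) = 1"
proof -
  obtain y z where "d y z = i"
    using ex_gdist assms by blast
  then show ?thesis
    using E_entry[of 0 y z x] by (simp add: E_0)
qed

text \<open>The linear map \<open>\<rho>\<close> puts |X| times row \<open>x\<close> of a matrix on
  the diagonal. It sends \<open>A i\<close> to a nonzero multiple of
  \<open>dual_idem adj x i\<close> and \<open>E j\<close> to \<open>A' j\<close>, so the two bases
  of \<open>M\<close> give two spanning sets of \<open>M'\<close>.\<close>

lemma dual_bose_mesner_eq_span: "M' = cmat.span (A' ` {0..D})"
proof -
  define \<rho> where "\<rho> = (\<lambda>R :: 'x cmat. (\<chi> y z. if y = z then of_nat CARD('x) * R $ x $ y else 0) :: 'x cmat)"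
  interpret \<rho>: module_hom cscale cscale \<rho>
    by unfold_locales (simp_all add: \<rho>_def vec_eq_iff algebra_simps)
  have \<rho>_A: "\<rho> (A i) = of_nat CARD('x) *\<^sub>C dual_idem adj x i" for i
    by (simp add: \<rho>_def vec_eq_iff dist_mat_def dual_idem_def)
  have "M' = cmat.span (\<rho> ` A ` {0..D})"
    unfolding dual_bose_mesner_def cmat.span_eq
  proof (intro conjI subsetI)
    fix w assume "w \<in> dual_idem adj x ` {0..D}"
    then obtain i where i: "i \<in> {0..D}" "w = dual_idem adj x i" by blast
    then have "w = (1 / of_nat CARD('x)) *\<^sub>C \<rho> (A i)"
      by (simp add: \<rho>_A)
    then show "w \<in> cmat.span (\<rho> ` A ` {0..D})"
      using i(1) by (simp add: cmat.span_scale cmat.span_base)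
  next
    fix w assume "w \<in> \<rho> ` A ` {0..D}"
    then show "w \<in> cmat.span (dual_idem adj x ` {0..D})"
      using cmat.span_scale[OF cmat.span_base[of _ "dual_idem adj x ` {0..D}"]] by (auto simp: \<rho>_A)
  qed
  also have "\<dots> = \<rho> ` M"
    by (simp add: \<rho>.span_image bose_mesner_def)
  also have "\<dots> = cmat.span (\<rho> ` E ` {0..D})"
    by (simp add: \<rho>.span_image span_E)
  also have "\<rho> ` E ` {0..D} = A' ` {0..D}"
    by (simp add: image_image \<rho>_def dual_dist_mat_def)
  finally show ?thesis .
qed

lemma bose_mesner_prod: "M \<odot> M' = cmat.span (e ` K)" "M' \<odot> M = cmat.span (f ` K)"
proof -
  have "{R ** S | R S. R \<in> A ` {0..D} \<and> S \<in> A' ` {0..D}} = e ` K"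
    "{R ** S | R S. R \<in> A' ` {0..D} \<and> S \<in> A ` {0..D}} = f ` K"
    by force+
  then show "M \<odot> M' = cmat.span (e ` K)" "M' \<odot> M = cmat.span (f ` K)"
    by (simp_all only: dual_bose_mesner_eq_span bose_mesner_def space_prod_span)
qed

lemma e_0_right: "e (i, 0) = A i"
  and e_0_left: "e (0, j) = A' j"
  by (simp_all add: A_0 A'_0)

lemma orthogonal_family_A: "orthogonal_family {0..D} A"
  by (rule orthogonal_family_comp[OF orthogonal_family_e, of "\<lambda>i. (i, 0)" "{0..D}", unfolded e_0_right])
     (auto simp: inj_on_def)

lemma orthogonal_family_A': "orthogonal_family {0..D} A'"
  by (rule orthogonal_family_comp[OF orthogonal_family_e, of "\<lambda>j. (0, j)" "{0..D}", unfolded e_0_left])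
     (auto simp: inj_on_def)

lemma herm_A_A':
  assumes "i \<le> D" "j \<le> D" "i \<noteq> 0 \<or> j \<noteq> 0"
  shows "herm (A i) (A' j) = 0"
  using herm_ee[of "(i, 0)" "(0, j)"] assms by (auto simp: A_0 A'_0)

lemma herm_A_A:
  assumes "i \<le> D" "j \<le> D" "i \<noteq> j"
  shows "herm (A i) (A j) = 0"
  using orthogonal_family_A assms by (simp add: orthogonal_family_def)

lemma herm_A'_A':
  assumes "i \<le> D" "j \<le> D" "i \<noteq> j"
  shows "herm (A' i) (A' j) = 0"
  using orthogonal_family_A' assms by (simp add: orthogonal_family_def)

text \<open>A common element is orthogonal to every \<open>A i\<close> with \<open>i\<close>
  positive, since these are orthogonal to all of \<open>M'\<close>; only the multiple of
  \<open>A 0\<close> survives.\<close>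

lemma bose_mesner_Int: "M \<inter> M' = cmat.span {mat 1}"
proof
  show "M \<inter> M' \<subseteq> cmat.span {mat 1}"
  proof
    fix w assume w: "w \<in> M \<inter> M'"
    have "w \<in> cmat.span (A ` ({0..D} - {1..D}))"
    proof (rule span_image_orthogonal_part[OF orthogonal_family_A])
      show "w \<in> cmat.span (A ` {0..D})"
        using w by (simp add: bose_mesner_def)
      show "herm w (A i) = 0" if "i \<in> {1..D}" for i
        by (rule herm_span_left[of w "A' ` {0..D}"])
          (use w that herm_A_A' herm_eq_0_commute[of _ "A i"] in \<open>auto simp: dual_bose_mesner_eq_span\<close>)
    qed auto
    also have "{0..D} - {1..D} = {0}" by auto
    finally show "w \<in> cmat.span {mat 1}"
      by (simp add: A_0)
  qed
  have "mat 1 \<in> A ` {0..D}" "mat 1 \<in> A' ` {0..D}"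
    using A_0 A'_0 by (metis atLeastAtMost_iff imageI le0 order_refl)+
  then show "cmat.span {mat 1} \<subseteq> M \<inter> M'"
    unfolding bose_mesner_def dual_bose_mesner_eq_span
    by (intro Int_greatest cmat.span_mono) auto
qed

section \<open>Complements of the algebras, their sums and products\<close>

lemma atLeastAtMost_diam_eq: "{0..D} = insert 0 {1..D}"
  by auto

lemma image_A: "A ` {0..D} = {mat 1} \<union> A ` {1..D}"
  and image_A': "A' ` {0..D} = {mat 1} \<union> A' ` {1..D}"
  unfolding atLeastAtMost_diam_eq by (simp_all add: A_0 A'_0)

lemma orthogonal_basis_bose_mesner_Int_perp:
  "orthogonal_basis {1..D} A (orth_in (M \<inter> M') M) \<and> cmat.dim (orth_in (M \<inter> M') M) = card {1..D}"
  "orthogonal_basis {1..D} A' (orth_in (M \<inter> M') M') \<and> cmat.dim (orth_in (M \<inter> M') M') = card {1..D}"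
proof -
  show "orthogonal_basis {1..D} A (orth_in (M \<inter> M') M) \<and> cmat.dim (orth_in (M \<inter> M') M) = card {1..D}"
  proof (rule orthogonal_basis_orth_in)
    show "M = M \<inter> M' + cmat.span (A ` {1..D})"
      unfolding bose_mesner_Int cmat_span_Un[symmetric] image_A[symmetric] by (simp add: bose_mesner_def)
    show "herm (A i) v = 0" if "i \<in> {1..D}" "v \<in> M \<inter> M'" for i v
      using that(2) unfolding bose_mesner_Int
      by (rule herm_span_right) (use that(1) herm_A_A[of i 0] in \<open>auto simp: A_0\<close>)
  qed (auto simp: bose_mesner_Int intro: orthogonal_family_subset[OF orthogonal_family_A])
  show "orthogonal_basis {1..D} A' (orth_in (M \<inter> M') M') \<and> cmat.dim (orth_in (M \<inter> M') M') = card {1..D}"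
  proof (rule orthogonal_basis_orth_in)
    show "M' = M \<inter> M' + cmat.span (A' ` {1..D})"
      unfolding bose_mesner_Int cmat_span_Un[symmetric] image_A'[symmetric]
      by (simp add: dual_bose_mesner_eq_span)
    show "herm (A' i) v = 0" if "i \<in> {1..D}" "v \<in> M \<inter> M'" for i v
      using that(2) unfolding bose_mesner_Int
      by (rule herm_span_right) (use that(1) herm_A'_A'[of i 0] in \<open>auto simp: A'_0\<close>)
  qed (auto simp: bose_mesner_Int intro: orthogonal_family_subset[OF orthogonal_family_A'])
qed

lemma bose_mesner_sum: "M + M' = cmat.span (A ` {0..D} \<union> A' ` {0..D})"
  by (simp add: bose_mesner_def dual_bose_mesner_eq_span cmat_span_Un)

text \<open>The two bases share just the identity, so adjoining the positive indices of one to the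
  other algebra already gives the sum.\<close>

lemma orthogonal_basis_bose_mesner_sum_perp:
  "orthogonal_basis {1..D} A' (orth_in M (M + M')) \<and> cmat.dim (orth_in M (M + M')) = card {1..D}"
  "orthogonal_basis {1..D} A (orth_in M' (M + M')) \<and> cmat.dim (orth_in M' (M + M')) = card {1..D}"
proof -
  show "orthogonal_basis {1..D} A' (orth_in M (M + M')) \<and> cmat.dim (orth_in M (M + M')) = card {1..D}"
  proof (rule orthogonal_basis_orth_in)
    have "A ` {0..D} \<union> A' ` {0..D} = A ` {0..D} \<union> A' ` {1..D}"
      unfolding image_A image_A' by blast
    then show "M + M' = M + cmat.span (A' ` {1..D})"
      unfolding bose_mesner_sum by (simp add: bose_mesner_def cmat_span_Un)
    show "herm (A' i) v = 0" if "i \<in> {1..D}" "v \<in> M" for i v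
      using that(2) unfolding bose_mesner_def
      by (rule herm_span_right)
         (use that(1) herm_A_A' herm_eq_0_commute[of "A' i"] in auto)
  qed (auto simp: bose_mesner_def intro: orthogonal_family_subset[OF orthogonal_family_A'])
  show "orthogonal_basis {1..D} A (orth_in M' (M + M')) \<and> cmat.dim (orth_in M' (M + M')) = card {1..D}"
  proof (rule orthogonal_basis_orth_in)
    have "A ` {0..D} \<union> A' ` {0..D} = A' ` {0..D} \<union> A ` {1..D}"
      unfolding image_A image_A' by blast
    then show "M + M' = M' + cmat.span (A ` {1..D})"
      unfolding bose_mesner_sum by (simp add: dual_bose_mesner_eq_span cmat_span_Un)
    show "herm (A i) v = 0" if "i \<in> {1..D}" "v \<in> M'" for i v
      using that(2) unfolding dual_bose_mesner_eq_span
      by (rule herm_span_right) (use that(1) herm_A_A' in auto)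
  qed (auto simp: dual_bose_mesner_eq_span intro: orthogonal_family_subset[OF orthogonal_family_A])
qed

lemma orthogonal_basis_prod_Int_perp:
  assumes S: "S = {a \<in> {1..D} \<times> {1..D}. r a = 1 \<or> r a = -1}"
  shows "orthogonal_basis S e (orth_in (M + M') ((M \<odot> M') \<inter> (M' \<odot> M))) \<and>
    cmat.dim (orth_in (M + M') ((M \<odot> M') \<inter> (M' \<odot> M))) = card S"
proof (rule orthogonal_basis_orth_in)
  let ?B = "{0..D} \<times> {0} \<union> {0} \<times> {0..D}"
  have "e ` ({0..D} \<times> {0}) = (\<lambda>i. e (i, 0)) ` {0..D}" "e ` ({0} \<times> {0..D}) = (\<lambda>j. e (0, j)) ` {0..D}"
    by auto
  then have "A ` {0..D} \<union> A' ` {0..D} = e ` ?B"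
    unfolding e_0_left e_0_right image_Un by (simp only:)
  then have sum: "M + M' = cmat.span (e ` ?B)"
    by (simp add: bose_mesner_sum)
  show "cmat.subspace (M + M')"
    by (simp add: sum)
  show "orthogonal_family S e"
    using orthogonal_family_e by (rule orthogonal_family_subset) (auto simp: S)
  \<comment> \<open>Pairs with a zero coordinate satisfy \<open>r a = 1\<close> and account for
    \<open>M + M'\<close>; \<open>S\<close> collects the other degenerate pairs.\<close>
  have "{a \<in> K. r a = 1 \<or> r a = -1} = ?B \<union> S"
  proof (intro set_eqI iffI)
    fix a assume "a \<in> ?B \<union> S"
    then show "a \<in> {a \<in> K. r a = 1 \<or> r a = -1}"
      using r_0_left r_0_right by (auto simp: S)
  qed (auto simp: S)
  then show "(M \<odot> M') \<inter> (M' \<odot> M) = M + M' + cmat.span (e ` S)"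
    unfolding bose_mesner_prod span_Int sum cmat_span_Un[symmetric] image_Un[symmetric] by simp
  show "herm (e a) v = 0" if "a \<in> S" "v \<in> M + M'" for a v
    using that(2) unfolding sum
  proof (rule herm_span_right)
    fix w assume "w \<in> e ` ?B"
    then obtain b where b: "b \<in> ?B" "w = e b" by blast
    then have "a \<in> K" "b \<in> K" "a \<noteq> b"
      using that(1) by (auto simp: S)
    then show "herm (e a) w = 0"
      by (simp only: b(2) herm_ee if_False)
  qed
qed

lemma orthogonal_basis_prod_perp:
  assumes N: "N = {a \<in> {1..D} \<times> {1..D}. \<not> (r a = 1 \<or> r a = -1)}"
  shows "orthogonal_basis N e (orth_in ((M \<odot> M') \<inter> (M' \<odot> M)) (M \<odot> M')) \<and>
      cmat.dim (orth_in ((M \<odot> M') \<inter> (M' \<odot> M)) (M \<odot> M')) = card N"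
    and "orthogonal_basis N f (orth_in ((M \<odot> M') \<inter> (M' \<odot> M)) (M' \<odot> M)) \<and>
      cmat.dim (orth_in ((M \<odot> M') \<inter> (M' \<odot> M)) (M' \<odot> M)) = card N"
    and "orthogonal_basis N (\<lambda>a. r a *\<^sub>C e a - f a) (orth_in (M \<odot> M') ((M \<odot> M') + (M' \<odot> M))) \<and>
      cmat.dim (orth_in (M \<odot> M') ((M \<odot> M') + (M' \<odot> M))) = card N"
    and "orthogonal_basis N (\<lambda>a. e a - r a *\<^sub>C f a) (orth_in (M' \<odot> M) ((M \<odot> M') + (M' \<odot> M))) \<and>
      cmat.dim (orth_in (M' \<odot> M) ((M \<odot> M') + (M' \<odot> M))) = card N"
proof -
  \<comment> \<open>A pair with \<open>r a\<close> different from 1 has both coordinates positive,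
    so \<open>N\<close> may be taken within \<open>K\<close>.\<close>
  have N': "N = {a \<in> K. \<not> (r a = 1 \<or> r a = -1)}"
  proof (intro set_eqI iffI)
    fix a assume a: "a \<in> {a \<in> K. \<not> (r a = 1 \<or> r a = -1)}"
    obtain i j where ij: "a = (i, j)" by (cases a)
    have "i \<le> D" "r (i, j) \<noteq> 1"
      using a by (auto simp: ij)
    then have "i \<noteq> 0" "j \<noteq> 0"
      using r_0_left[of j] r_0_right[of i] by metis+
    then show "a \<in> N"
      using a by (auto simp: N ij)
  qed (auto simp: N)
  interpret swapped: orthogonal_planes K f e n r
    by (rule swap)
  note prod = bose_mesner_prod
  show "orthogonal_basis N e (orth_in ((M \<odot> M') \<inter> (M' \<odot> M)) (M \<odot> M')) \<and>
      cmat.dim (orth_in ((M \<odot> M') \<inter> (M' \<odot> M)) (M \<odot> M')) = card N"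
    unfolding prod by (rule orthogonal_basis_Int_perp[OF N' refl])
  show "orthogonal_basis N f (orth_in ((M \<odot> M') \<inter> (M' \<odot> M)) (M' \<odot> M)) \<and>
      cmat.dim (orth_in ((M \<odot> M') \<inter> (M' \<odot> M)) (M' \<odot> M)) = card N"
    unfolding prod by (rule swapped.orthogonal_basis_Int_perp[OF N' Int_commute])
  show "orthogonal_basis N (\<lambda>a. r a *\<^sub>C e a - f a) (orth_in (M \<odot> M') ((M \<odot> M') + (M' \<odot> M))) \<and>
      cmat.dim (orth_in (M \<odot> M') ((M \<odot> M') + (M' \<odot> M))) = card N"
    unfolding prod by (rule orthogonal_basis_sum_perp[OF N' refl]) (rule disjI1[OF refl])
  show "orthogonal_basis N (\<lambda>a. e a - r a *\<^sub>C f a) (orth_in (M' \<odot> M) ((M \<odot> M') + (M' \<odot> M))) \<and>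
      cmat.dim (orth_in (M' \<odot> M) ((M \<odot> M') + (M' \<odot> M))) = card N"
    unfolding prod by (rule swapped.orthogonal_basis_sum_perp[OF N' add.commute]) (rule disjI2[OF refl])
qed

end

theorem theorem6p2:
  fixes adj :: "'x::finite \<Rightarrow> 'x \<Rightarrow> bool"
    and x :: 'x
    and E :: "nat \<Rightarrow> 'x cmat"
    and \<theta> :: "nat \<Rightarrow> complex"
    and u :: "nat \<Rightarrow> complex poly"
  defines "D \<equiv> diam adj"
    and "A \<equiv> dist_mat adj"
    and "A' \<equiv> dual_dist_mat E x"
    and "M \<equiv> bose_mesner adj"
    and "M' \<equiv> dual_bose_mesner adj x"
  defines "S \<equiv> {(i, j). i \<in> {1..D} \<and> j \<in> {1..D} \<and>
                 (poly (u i) (\<theta> j) = 1 \<or> poly (u i) (\<theta> j) = -1)}"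
    and "N \<equiv> {(i, j). i \<in> {1..D} \<and> j \<in> {1..D} \<and>
                 \<not> (poly (u i) (\<theta> j) = 1 \<or> poly (u i) (\<theta> j) = -1)}"
  defines "P \<equiv> card S"
  assumes "distance_regular adj"
    and "D \<ge> 3"
    and "primitive_idempotents adj E"
    and "\<forall>i\<le>D. A 1 ** E i = \<theta> i *\<^sub>C E i"
    and "u_polys adj u"
  shows
    "(orthogonal_basis {1..D} A (orth_in (M \<inter> M') M) \<and>
       cmat.dim (orth_in (M \<inter> M') M) = D) \<and>
     (orthogonal_basis {1..D} A' (orth_in (M \<inter> M') M') \<and>
       cmat.dim (orth_in (M \<inter> M') M') = D) \<and>
     (orthogonal_basis {1..D} A' (orth_in M (M + M')) \<and>
       cmat.dim (orth_in M (M + M')) = D) \<and>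
     (orthogonal_basis {1..D} A (orth_in M' (M + M')) \<and>
       cmat.dim (orth_in M' (M + M')) = D) \<and>
     (orthogonal_basis S (\<lambda>(i, j). A i ** A' j) (orth_in (M + M') ((M \<odot> M') \<inter> (M' \<odot> M))) \<and>
       cmat.dim (orth_in (M + M') ((M \<odot> M') \<inter> (M' \<odot> M))) = P) \<and>
     (orthogonal_basis N (\<lambda>(i, j). A i ** A' j) (orth_in ((M \<odot> M') \<inter> (M' \<odot> M)) (M \<odot> M')) \<and>
       int (cmat.dim (orth_in ((M \<odot> M') \<inter> (M' \<odot> M)) (M \<odot> M'))) = int D ^ 2 - int P) \<and>
     (orthogonal_basis N (\<lambda>(i, j). A' j ** A i) (orth_in ((M \<odot> M') \<inter> (M' \<odot> M)) (M' \<odot> M)) \<and>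
       int (cmat.dim (orth_in ((M \<odot> M') \<inter> (M' \<odot> M)) (M' \<odot> M))) = int D ^ 2 - int P) \<and>
     (orthogonal_basis N (\<lambda>(i, j). poly (u i) (\<theta> j) *\<^sub>C (A i ** A' j) - A' j ** A i)
         (orth_in (M \<odot> M') ((M \<odot> M') + (M' \<odot> M))) \<and>
       int (cmat.dim (orth_in (M \<odot> M') ((M \<odot> M') + (M' \<odot> M)))) = int D ^ 2 - int P) \<and>
     (orthogonal_basis N (\<lambda>(i, j). A i ** A' j - poly (u i) (\<theta> j) *\<^sub>C (A' j ** A i))
         (orth_in (M' \<odot> M) ((M \<odot> M') + (M' \<odot> M))) \<and>
       int (cmat.dim (orth_in (M' \<odot> M) ((M \<odot> M') + (M' \<odot> M)))) = int D ^ 2 - int P)"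
proof -
  interpret distance_regular_idempotents adj E \<theta> u x
    using assms(9-) by unfold_locales (simp_all add: D_def A_def)
  have S: "S = {a \<in> {1..D} \<times> {1..D}. r a = 1 \<or> r a = -1}"
    and N: "N = {a \<in> {1..D} \<times> {1..D}. \<not> (r a = 1 \<or> r a = -1)}"
    unfolding S_def N_def D_def by auto
  have "S \<union> N = {1..D} \<times> {1..D}" "S \<inter> N = {}" "finite S" "finite N"
    by (auto simp: S N)
  \<comment> \<open>\<open>S\<close> and \<open>N\<close> partition the D by D square of positive
    indices.\<close>
  then have "card S + card N = D * D"
    using card_Un_disjoint[of S N] by (simp add: card_cartesian_product)
  then have card_N: "int (card N) = int D ^ 2 - int P"
    unfolding P_def power2_eq_square
    by (metis add_diff_cancel_left' of_nat_add of_nat_mult)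
  note parts = orthogonal_basis_bose_mesner_Int_perp orthogonal_basis_bose_mesner_sum_perp orthogonal_basis_prod_Int_perp[OF S[unfolded D_def]]
    orthogonal_basis_prod_perp[OF N[unfolded D_def]]
  show ?thesis
    using parts card_N unfolding A_def A'_def M_def M'_def P_def D_def
    by (simp add: case_prod_unfold)
qed

end
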